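(* If for all $j,k\in\mathcal S^m$ either $N_j\subset N_k$, or $N_k\subset N_j$, or $N_j\cap N_k=\emptyset$, then there exists a viable ranking of the jobs in $\mathcal S^m$.
   Context: **Network.** $\mathbb N_n=\{1,\dots,n\}$. $K$ is an $I\times J$ matrix with entries in $\{0,1\}$ and nonzero, pairwise distinct columns $K_1,\dots,K_J$; $N_j=\{i\in\mathbb N_I:K_{ij}=1\}$; $\mathcal S^1=\{j\in\mathbb N_J:|N_j|=1\}$. Local traffic assumption: $\bigcup_{j\in\mathcal S^1}N_j=\mathbb N_I$. $\mu_j\in(0,\infty)$ for $j\in\mathbb N_J$ and $h\in(0,\infty)^J$ are given. **Workload cost and job classes.** $M=\mathrm{diag}(1/\mu_j)$, $G=KM$ with columns $g_j$. For $w\in\mathbb R_+^I$: $\mathcal Q(w)=\{q\in\mathbb R_+^J:Gq=w\}$, $\mathcal C(w)=\inf_{q\in\mathcal Q(w)}h\cdot q$. $\mathcal S^p=\{j:\mathcal C(g_j)<h_j\}$ (primary jobs), $\mathcal S^s=\mathbb N_J\setminus\mathcal S^p$ (secondary jobs; contains $\mathcal S^1$), $\mathcal S^m=\mathcal S^s\setminus\mathcal S^1$, $m=|\mathcal S^m|$. **Viable ranking.** For $E,F\subset\mathbb N_J$ and $k\in\mathbb N_J$, $\mathcal M_F^{E,k}$ is the collection of sets $D\subset E\setminus\{k\}$ with $N_k\subset\bigcup_{j\in D}N_j$, $N_k\not\subset\bigcup_{j\in D\setminus\{l\}}N_j$ for all $l\in D$, and $N_l\not\subset\bigcup_{j\in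 D}N_j$ for all $l\in F$. For $E,F\subset\mathcal S^m$, $\mathcal O_F^E$ is the set of $j'\in E$ such that $$\mu_{j'}h_{j'}+\mathcal C\Big(\sum_{j\in D}K_j-K_{j'}\Big)\le\mathcal C\Big(\sum_{j\in D}K_j\Big)\quad\text{for all }D\in\mathcal M_F^{E\cup\mathcal S^1,j'}.$$ A viable ranking of jobs in $\mathcal S^m$ is a bijection $\rho:\mathbb N_m\to\mathcal S^m$ such that for all $k\in\mathbb N_m$, $\rho(k)\in\mathcal O_{F_k}^{E_k}$, where $F_k=\{\rho(1),\dots,\rho(k-1)\}$ and $E_k=\mathcal S^m\setminus F_k$ (so $F_1=\emptyset$). *)

theory Defs
  imports "HOL-Analysis.Analysis"
begin

text \<open>The index sets of resources (rows, $1,\dots,I$) and of jobs (columns, $1,\dots,J$) are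
  arbitrary finite types \<open>'i\<close> and \<open>'j\<close>.\<close>

definition resources :: "real ^ 'j ^ 'i \<Rightarrow> 'j \<Rightarrow> 'i set" where
  "resources K j = {i. K $ i $ j = 1}"

definition single_jobs :: "real ^ 'j ^ 'i \<Rightarrow> 'j set" where
  "single_jobs K = {j. card (resources K j) = 1}"

definition local_traffic :: "real ^ 'j ^ 'i \<Rightarrow> bool" where
  "local_traffic K \<longleftrightarrow> (\<Union>j\<in>single_jobs K. resources K j) = UNIV"

definition M_mat :: "real ^ 'j \<Rightarrow> real ^ 'j ^ 'j" where
  "M_mat \<mu> = (\<chi> j k. if j = k then 1 / \<mu> $ j else 0)"

definition G_mat :: "real ^ 'j ^ 'i \<Rightarrow> real ^ 'j \<Rightarrow> real ^ 'j ^ 'i" where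
  "G_mat K \<mu> = K ** M_mat \<mu>"

definition queue_set :: "real ^ 'j ^ 'i \<Rightarrow> real ^ 'j \<Rightarrow> real ^ 'i \<Rightarrow> (real ^ 'j) set" where
  "queue_set K \<mu> w = {q. (\<forall>j. 0 \<le> q $ j) \<and> G_mat K \<mu> *v q = w}"

text \<open>Only meaningful for componentwise nonnegative \<open>w\<close>. For such \<open>w\<close>, under local traffic and
  with \<open>\<mu>\<close> and \<open>h\<close> positive, the set below is nonempty and bounded below by \<open>0\<close>, so that the
  infimum in \<open>real\<close> is the usual one.\<close>

definition workload_cost ::
    "real ^ 'j ^ 'i \<Rightarrow> real ^ 'j \<Rightarrow> real ^ 'j \<Rightarrow> real ^ 'i \<Rightarrow> real" where
  "workload_cost K \<mu> h w = (INF q\<in>queue_set K \<mu> w. h \<bullet> q)"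

definition primary_jobs :: "real ^ 'j ^ 'i \<Rightarrow> real ^ 'j \<Rightarrow> real ^ 'j \<Rightarrow> 'j set" where
  "primary_jobs K \<mu> h = {j. workload_cost K \<mu> h (column j (G_mat K \<mu>)) < h $ j}"

definition secondary_jobs :: "real ^ 'j ^ 'i \<Rightarrow> real ^ 'j \<Rightarrow> real ^ 'j \<Rightarrow> 'j set" where
  "secondary_jobs K \<mu> h = UNIV - primary_jobs K \<mu> h"

definition multi_secondary_jobs :: "real ^ 'j ^ 'i \<Rightarrow> real ^ 'j \<Rightarrow> real ^ 'j \<Rightarrow> 'j set" where
  "multi_secondary_jobs K \<mu> h = secondary_jobs K \<mu> h - single_jobs K"

text \<open>\<open>minimal_covers K E F k\<close> is $\mathcal M_F^{E,k}$ and \<open>rank_candidates K \<mu> h E F\<close> is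
  $\mathcal O_F^E$.\<close>

definition minimal_covers :: "real ^ 'j ^ 'i \<Rightarrow> 'j set \<Rightarrow> 'j set \<Rightarrow> 'j \<Rightarrow> 'j set set" where
  "minimal_covers K E F k =
     {D. D \<subseteq> E - {k}
         \<and> resources K k \<subseteq> (\<Union>j\<in>D. resources K j)
         \<and> (\<forall>l\<in>D. \<not> resources K k \<subseteq> (\<Union>j\<in>D - {l}. resources K j))
         \<and> (\<forall>l\<in>F. \<not> resources K l \<subseteq> (\<Union>j\<in>D. resources K j))}"

definition rank_candidates ::
    "real ^ 'j ^ 'i \<Rightarrow> real ^ 'j \<Rightarrow> real ^ 'j \<Rightarrow> 'j set \<Rightarrow> 'j set \<Rightarrow> 'j set" where
  "rank_candidates K \<mu> h E F =
     {j'\<in>E. \<forall>D\<in>minimal_covers K (E \<union> single_jobs K) F j'.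
        \<mu> $ j' * h $ j' + workload_cost K \<mu> h ((\<Sum>j\<in>D. column j K) - column j' K)
          \<le> workload_cost K \<mu> h (\<Sum>j\<in>D. column j K)}"

definition viable_ranking ::
    "real ^ 'j ^ 'i \<Rightarrow> real ^ 'j \<Rightarrow> real ^ 'j \<Rightarrow> (nat \<Rightarrow> 'j) \<Rightarrow> bool" where
  "viable_ranking K \<mu> h \<rho> \<longleftrightarrow>
     bij_betw \<rho> {1..card (multi_secondary_jobs K \<mu> h)} (multi_secondary_jobs K \<mu> h) \<and>
     (\<forall>k\<in>{1..card (multi_secondary_jobs K \<mu> h)}.
        \<rho> k \<in> rank_candidates K \<mu> h (multi_secondary_jobs K \<mu> h - \<rho> ` {1..<k}) (\<rho> ` {1..<k}))"

end

theory Submission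
  imports Defs
begin

text \<open>Rank the jobs by decreasing number of resources. By nestedness, a minimal cover of \<open>N\<^sub>k\<close>
  by single jobs and jobs ranked after \<open>k\<close> consists of pairwise disjoint subsets of \<open>N\<^sub>k\<close>, so that its
  columns add up to \<open>K\<^sub>k\<close>. The inequality defining a candidate thus becomes
  \<open>\<mu>\<^sub>k h\<^sub>k + \<C>(0) \<le> \<C>(K\<^sub>k)\<close>, which holds by homogeneity of \<open>\<C>\<close> because \<open>k\<close> is secondary.\<close>

text \<open>Sorting a list of the elements by \<open>f\<close> produces the ranking. Minimality is
  stated against everything not yet ranked because this is the set of jobs from which
  \<open>rank_candidates\<close> chooses at rank \<open>k\<close>.\<close>

lemma ex_sorted_enumeration:
  fixes f :: "'a \<Rightarrow> 'b::linorder"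
  assumes "finite S"
  shows "\<exists>\<rho>. bij_betw \<rho> {1..card S} S \<and>
           (\<forall>k\<in>{1..card S}. \<forall>l\<in>S - \<rho> ` {1..<k}. f (\<rho> k) \<le> f l)"
proof -
  obtain xs where xs: "set xs = S" "distinct xs"
    using finite_distinct_list[OF assms] by blast
  define ys where "ys = sort_key f xs"
  have ys: "set ys = S" "distinct ys" "sorted (map f ys)"
    using xs by (simp_all add: ys_def)
  have len: "length ys = card S"
    using distinct_card[OF ys(2)] ys(1) by simp
  \<comment> \<open>Ranks start at 1, list positions at 0.\<close>
  define \<rho> where "\<rho> = (\<lambda>k. ys ! (k - 1))"
  have "bij_betw (\<lambda>k. k - 1) {1..card S} {..<card S}"
    by (rule bij_betw_byWitness[where f' = Suc]) auto
  then have "bij_betw ((!) ys \<circ> (\<lambda>k. k - 1)) {1..card S} S"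
    by (rule bij_betw_trans) (rule bij_betw_nth[OF ys(2)], simp_all only: ys(1) len)
  then have "bij_betw \<rho> {1..card S} S"
    by (simp add: \<rho>_def comp_def)
  moreover have "f (\<rho> k) \<le> f l" if k: "k \<in> {1..card S}" and l: "l \<in> S - \<rho> ` {1..<k}" for k l
  proof -
    obtain i where i: "i < card S" "l = ys ! i"
      using l ys(1) len by (metis DiffD1 in_set_conv_nth)
    \<comment> \<open>The element at position \<open>i\<close> has rank \<open>Suc i\<close>; being
      unranked before \<open>k\<close>, it cannot sit at a position below
      \<open>k - 1\<close>.\<close>
    have "\<not> Suc i < k"
    proof
      assume "Suc i < k"
      then have "\<rho> (Suc i) \<in> \<rho> ` {1..<k}" by (intro imageI) simp
      then show False using l i by (simp add: \<rho>_def)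
    qed
    then have "k - 1 \<le> i" by simp
    then show ?thesis
      using sorted_nth_mono[OF ys(3), of "k - 1" i] i len by (simp add: \<rho>_def)
  qed
  ultimately show ?thesis by blast
qed

text \<open>An infimum over reals lies below its members only if the set is bounded below; positive
  holding costs and nonnegative queues give the bound 0.\<close>

lemma workload_cost_le:
  assumes "\<And>j. 0 < h $ j" and "q \<in> queue_set K \<mu> w"
  shows "workload_cost K \<mu> h w \<le> h \<bullet> q"
  unfolding workload_cost_def
proof (rule cINF_lower[OF _ assms(2)])
  show "bdd_below ((\<bullet>) h ` queue_set K \<mu> w)"
    by (rule bdd_belowI[of _ 0])
      (auto simp: queue_set_def inner_vec_def intro!: sum_nonneg mult_nonneg_nonneg less_imp_le[OF assms(1)])
qed

lemma G_mat_mult_vec_nth: "(G_mat K \<mu> *v q) $ i = (\<Sum>j\<in>UNIV. K $ i $ j * q $ j / \<mu> $ j)"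
proof -
  have "(\<Sum>k\<in>UNIV. K $ i $ k * (if k = j then 1 / \<mu> $ j else 0)) = K $ i $ j / \<mu> $ j" for j
  proof -
    have "(\<Sum>k\<in>UNIV. K $ i $ k * (if k = j then 1 / \<mu> $ j else 0))
        = (\<Sum>k\<in>UNIV. if k = j then K $ i $ k / \<mu> $ j else 0)"
      by (rule sum.cong) auto
    then show ?thesis by simp
  qed
  moreover have "M_mat \<mu> $ k $ j = (if k = j then 1 / \<mu> $ j else 0)" for k j
    by (simp add: M_mat_def)
  ultimately show ?thesis
    by (simp add: G_mat_def matrix_matrix_mult_def matrix_vector_mult_def)
qed

text \<open>The workload of a queue holding a single job class. It serves to read off the columns of
  \<open>G_mat\<close> and to exhibit a queue with workload \<open>column k K\<close>.\<close>

lemma G_mat_mult_axis: "G_mat K \<mu> *v axis j c = (c / \<mu> $ j) *\<^sub>R column j K"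
proof -
  have "(\<Sum>k\<in>UNIV. K $ i $ k * axis j c $ k / \<mu> $ k) = c / \<mu> $ j * K $ i $ j" for i
  proof -
    have "(\<Sum>k\<in>UNIV. K $ i $ k * axis j c $ k / \<mu> $ k)
        = (\<Sum>k\<in>UNIV. if k = j then c / \<mu> $ k * K $ i $ k else 0)"
      by (rule sum.cong) (auto simp: axis_def)
    then show ?thesis by simp
  qed
  then show ?thesis
    by (simp add: vec_eq_iff G_mat_mult_vec_nth column_def)
qed

lemma column_G_mat: "column j (G_mat K \<mu>) = (1 / \<mu> $ j) *\<^sub>R column j K"
  by (metis G_mat_mult_axis matrix_vector_mult_basis)

text \<open>Homogeneity: dividing a queue for \<open>column k K\<close> by \<open>\<mu> $ k\<close>
  gives a queue for the column of \<open>G_mat\<close>, whose cost is at least \<open>h $ k\<close>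
  for a secondary job.\<close>

lemma workload_cost_column_ge:
  assumes \<mu>: "0 < \<mu> $ k" and h: "\<And>j. 0 < h $ j" and k: "k \<in> secondary_jobs K \<mu> h"
  shows "\<mu> $ k * h $ k \<le> workload_cost K \<mu> h (column k K)"
  unfolding workload_cost_def
proof (rule cINF_greatest)
  \<comment> \<open>The infimum is bounded below by its lower bounds only over a nonempty set;
    \<open>\<mu> $ k\<close> jobs of class \<open>k\<close> alone carry the workload.\<close>
  have "axis k (\<mu> $ k) \<in> queue_set K \<mu> (column k K)"
    using \<mu> by (simp add: queue_set_def G_mat_mult_axis) (simp add: axis_def)
  then show "queue_set K \<mu> (column k K) \<noteq> {}" by blast
  fix q assume "q \<in> queue_set K \<mu> (column k K)"
  then have "(1 / \<mu> $ k) *\<^sub>R q \<in> queue_set K \<mu> (column k (G_mat K \<mu>))"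
    using \<mu> by (auto simp: queue_set_def column_G_mat matrix_vector_mult_scaleR)
  then have "workload_cost K \<mu> h (column k (G_mat K \<mu>)) \<le> h \<bullet> ((1 / \<mu> $ k) *\<^sub>R q)"
    by (rule workload_cost_le[OF h])
  moreover have "h $ k \<le> workload_cost K \<mu> h (column k (G_mat K \<mu>))"
    using k by (simp add: secondary_jobs_def primary_jobs_def not_less)
  ultimately have "h $ k \<le> (h \<bullet> q) / \<mu> $ k" by simp
  then show "\<mu> $ k * h $ k \<le> h \<bullet> q"
    using \<mu> by (simp add: field_simps)
qed

text \<open>Columns are indicator vectors of resource sets, so it suffices that the sets of
  \<open>D\<close> partition that of \<open>k\<close>. By minimality no member of \<open>D\<close>
  is redundant: one disjoint from the resources of \<open>k\<close>, or one contained in another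
  member, could be dropped. What \<open>nested\<close> and \<open>below\<close> leave are pairwise
  disjoint subsets.\<close>

lemma sum_columns_minimal_cover:
  fixes K :: "real ^ 'j ^ 'i"
  assumes K01: "\<And>i j. K $ i $ j \<in> {0, 1}"
    and D: "D \<in> minimal_covers K E F k"
    and nested: "\<And>j l. j \<in> D \<Longrightarrow> l \<in> D \<Longrightarrow>
      resources K j \<subseteq> resources K l \<or> resources K l \<subseteq> resources K j \<or>
      resources K j \<inter> resources K l = {}"
    and below: "\<And>j. j \<in> D \<Longrightarrow>
      resources K j \<subseteq> resources K k \<or> resources K j \<inter> resources K k = {}"
  shows "(\<Sum>j\<in>D. column j K) = column k K"
proof -
  let ?N = "resources K"
  have cover: "?N k \<subseteq> (\<Union>j\<in>D. ?N j)"
    and minimal: "\<And>l. l \<in> D \<Longrightarrow> \<not> ?N k \<subseteq> (\<Union>j\<in>D - {l}. ?N j)"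
    using D by (auto simp: minimal_covers_def)
  have entry: "K $ i $ j = indicat_real (?N j) i" for i j
    using K01[of i j] by (auto simp: resources_def)
  have sub: "?N j \<subseteq> ?N k" if "j \<in> D" for j
  proof (rule ccontr)
    assume "\<not> ?N j \<subseteq> ?N k"
    then have "?N j \<inter> ?N k = {}" using below that by blast
    then show False using minimal[OF that] cover by blast
  qed
  then have union: "(\<Union>j\<in>D. ?N j) = ?N k" using cover by blast
  have not_sub: "\<not> ?N j \<subseteq> ?N l" if "j \<in> D" "l \<in> D" "j \<noteq> l" for j l
  proof
    assume "?N j \<subseteq> ?N l"
    then have "?N k \<subseteq> (\<Union>j\<in>D - {j}. ?N j)"
      using cover that by blast
    then show False using minimal that by blast
  qed
  have "disjoint_family_on ?N D"
    unfolding disjoint_family_on_def using nested not_sub by metis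
  then have "indicat_real (?N k) i = (\<Sum>j\<in>D. indicat_real (?N j) i)" for i
    using indicator_UN_disjoint[of D ?N i] union by simp
  then show ?thesis
    by (simp add: vec_eq_iff column_def entry)
qed

theorem theorem5p1:
  fixes K :: "real ^ 'j ^ 'i" and \<mu> h :: "real ^ 'j"
  assumes "\<And>i j. K $ i $ j \<in> {0, 1}"
    and "\<And>j. column j K \<noteq> 0"
    and "inj (\<lambda>j. column j K)"
    and "local_traffic K"
    and "\<And>j. 0 < \<mu> $ j"
    and "\<And>j. 0 < h $ j"
    and "\<And>j k. j \<in> multi_secondary_jobs K \<mu> h \<Longrightarrow> k \<in> multi_secondary_jobs K \<mu> h \<Longrightarrow>
           resources K j \<subseteq> resources K k \<or> resources K k \<subseteq> resources K j \<or>
           resources K j \<inter> resources K k = {}"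
  shows "\<exists>\<rho>. viable_ranking K \<mu> h \<rho>"
proof -
  let ?S = "multi_secondary_jobs K \<mu> h" and ?N = "resources K"
  have inj_N: "j = l" if "?N j = ?N l" for j l
  proof -
    have "K $ i $ j = 1 \<longleftrightarrow> K $ i $ l = 1" for i
      using that by (simp add: resources_def set_eq_iff)
    then have "K $ i $ j = K $ i $ l" for i
      using assms(1)[of i j] assms(1)[of i l] by (metis empty_iff insert_iff)
    then have "column j K = column l K" by (simp add: column_def)
    then show ?thesis by (rule injD[OF assms(3)])
  qed
  have single: "?N j \<subseteq> A \<or> ?N j \<inter> A = {}" if "j \<in> single_jobs K" for j A
    using that by (auto simp: single_jobs_def card_1_singleton_iff)
  \<comment> \<open>Covers may also use single jobs, so nestedness is extended to them: a singleton
    is inside or disjoint from any set.\<close>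
  have nested: "?N j \<subseteq> ?N l \<or> ?N l \<subseteq> ?N j \<or> ?N j \<inter> ?N l = {}"
    if "j \<in> ?S \<union> single_jobs K" "l \<in> ?S \<union> single_jobs K" for j l
  proof (cases "j \<in> single_jobs K \<or> l \<in> single_jobs K")
    case True
    then show ?thesis using single[of j "?N l"] single[of l "?N j"] by blast
  next
    case False
    then show ?thesis using that assms(7)[of j l] by blast
  qed
  obtain \<rho> where bij: "bij_betw \<rho> {1..card ?S} ?S"
    and decreasing: "\<And>k l. k \<in> {1..card ?S} \<Longrightarrow> l \<in> ?S - \<rho> ` {1..<k} \<Longrightarrow>
      card (?N l) \<le> card (?N (\<rho> k))"
    \<comment> \<open>Negation, taken in \<open>int\<close>, turns increasing order into decreasing
      cardinality.\<close>
    using ex_sorted_enumeration[of ?S "\<lambda>j. - int (card (?N j))"] by auto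
  have "\<rho> k \<in> rank_candidates K \<mu> h (?S - \<rho> ` {1..<k}) (\<rho> ` {1..<k})"
    if k: "k \<in> {1..card ?S}" for k
  proof -
    let ?E = "?S - \<rho> ` {1..<k}"
    have \<rho>S: "\<rho> k \<in> ?S" using bij k by (auto simp: bij_betw_def)
    have "\<rho> k \<notin> \<rho> ` {1..<k}"
    proof
      assume "\<rho> k \<in> \<rho> ` {1..<k}"
      then obtain l where l: "1 \<le> l" "l < k" "\<rho> l = \<rho> k" by auto
      then have "l = k"
        using inj_onD[OF bij_betw_imp_inj_on[OF bij] l(3)] k by simp
      then show False using l by simp
    qed
    moreover have "\<mu> $ \<rho> k * h $ \<rho> k
        + workload_cost K \<mu> h ((\<Sum>j\<in>D. column j K) - column (\<rho> k) K)
        \<le> workload_cost K \<mu> h (\<Sum>j\<in>D. column j K)"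
      if D: "D \<in> minimal_covers K (?E \<union> single_jobs K) (\<rho> ` {1..<k}) (\<rho> k)" for D
    proof -
      have DE: "D \<subseteq> ?E \<union> single_jobs K" "\<rho> k \<notin> D"
        using D by (auto simp: minimal_covers_def)
      have "?N j \<subseteq> ?N (\<rho> k) \<or> ?N j \<inter> ?N (\<rho> k) = {}" if j: "j \<in> D" for j
      proof (cases "j \<in> single_jobs K")
        case False
        then have jE: "j \<in> ?E" using DE j by blast
        \<comment> \<open>A job still unranked has at most as many resources as
          \<open>\<rho> k\<close>, whereas a proper superset would have more.\<close>
        then have "\<not> ?N (\<rho> k) \<subset> ?N j"
          using decreasing[OF k jE] psubset_card_mono[of "?N j" "?N (\<rho> k)"] by auto
        moreover have "?N j \<noteq> ?N (\<rho> k)" using inj_N DE j by blast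
        ultimately show ?thesis using nested[of j "\<rho> k"] jE \<rho>S by blast
      qed (rule single)
      moreover have "?N j \<subseteq> ?N l \<or> ?N l \<subseteq> ?N j \<or> ?N j \<inter> ?N l = {}"
        if "j \<in> D" "l \<in> D" for j l
        by (rule nested) (use DE that in blast)+
      ultimately have sum: "(\<Sum>j\<in>D. column j K) = column (\<rho> k) K"
        by (intro sum_columns_minimal_cover[OF assms(1) D])
      \<comment> \<open>By \<open>sum\<close> the workload left after removing the column of
        \<open>\<rho> k\<close> is zero, and the empty queue serves it at no cost. Only this upper
        bound on the cost of 0 enters the inequality.\<close>
      have "0 \<in> queue_set K \<mu> 0" by (simp add: queue_set_def)
      then have "workload_cost K \<mu> h 0 \<le> 0"
        using workload_cost_le[OF assms(6)] by fastforce
      moreover have "\<rho> k \<in> secondary_jobs K \<mu> h"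
        using \<rho>S by (simp add: multi_secondary_jobs_def)
      ultimately show ?thesis
        using workload_cost_column_ge[of \<mu> "\<rho> k" h K] assms(5,6) sum by force
    qed
    ultimately show ?thesis using \<rho>S by (simp add: rank_candidates_def)
  qed
  then show ?thesis using bij unfolding viable_ranking_def by blast
qed

end
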